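(* Let $D$ be a principal ideal domain and let $A$ be an $n\times n$ matrix over the polynomial ring $D[x]$. Suppose $A$ is not nilpotent, and let $l=\min\{k\in\mathbb{N} : \operatorname{rank}(A^k)=\operatorname{rank}(A^{k+1})\}$. Then there is an algebraic strong shift equivalence of lag $l$ over $D[x]$ from $A$ to a nonsingular square matrix over $D[x]$. In particular, every non-nilpotent square matrix over $D[x]$ is algebraically strong shift equivalent over $D[x]$ to a nonsingular matrix.
   Context: Rings are commutative. The rank of a matrix over the domain $D[x]$ is the largest order of a nonzero minor (equivalently, its rank over the fraction field); a square matrix is nonsingular if its determinant is nonzero. Two square matrices $A,B$ (possibly of different orders) over a ring $R$ are elementarily strong shift equivalent over $R$ if there exist (rectangular) matrices $U,V$ over $R$ with $A=UV$ and $B=VU$. $A$ and $B$ are algebraically strong shift equivalent over $R$ of lag $l$ if there is a chain $A=A_0,A_1,\dots,A_l=B$ of square matrices over $R$ such that $A_{i-1}$ and $A_i$ are elementarily strong shift equivalent over $R$ for each $i=1,\dots,l$. *)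

theory Defs
  imports "HOL-Computational_Algebra.Polynomial" "Jordan_Normal_Form.Determinant"
    "Jordan_Normal_Form.DL_Submatrix"
begin

class pid = idom +
  assumes every_ideal_principal:
    "0 \<in> I \<Longrightarrow> (\<forall>x\<in>I. \<forall>y\<in>I. x + y \<in> I) \<Longrightarrow> (\<forall>r. \<forall>x\<in>I. r * x \<in> I)
     \<Longrightarrow> \<exists>g. I = {r * g | r. True}"

definition minor_rank :: "'a::comm_ring_1 mat \<Rightarrow> nat" where
  "minor_rank A = Max {k. \<exists>I J. I \<subseteq> {..<dim_row A} \<and> J \<subseteq> {..<dim_col A} \<and>
       card I = k \<and> card J = k \<and> det (submatrix A I J) \<noteq> 0}"

definition nilpotent_mat :: "'a::comm_ring_1 mat \<Rightarrow> bool" where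
  "nilpotent_mat A \<longleftrightarrow> (\<exists>k. A ^\<^sub>m k = 0\<^sub>m (dim_row A) (dim_col A))"

definition elem_sse :: "'a::comm_ring_1 mat \<Rightarrow> 'a mat \<Rightarrow> bool" where
  "elem_sse A B \<longleftrightarrow> (\<exists>U V. U \<in> carrier_mat (dim_row A) (dim_row B) \<and>
       V \<in> carrier_mat (dim_row B) (dim_row A) \<and>
       A \<in> carrier_mat (dim_row A) (dim_row A) \<and> B \<in> carrier_mat (dim_row B) (dim_row B) \<and>
       A = U * V \<and> B = V * U)"

definition alg_sse_lag :: "nat \<Rightarrow> 'a::comm_ring_1 mat \<Rightarrow> 'a mat \<Rightarrow> bool" where
  "alg_sse_lag l A B \<longleftrightarrow> (\<exists>C :: nat \<Rightarrow> 'a mat. C 0 = A \<and> C l = B \<and>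
       (\<forall>i\<le>l. C i \<in> carrier_mat (dim_row (C i)) (dim_row (C i))) \<and>
       (\<forall>i<l. elem_sse (C i) (C (Suc i))))"

end

theory Submission
  imports Defs "HOL-Computational_Algebra.Polynomial_Factorial"
begin

text \<open>
  Everything rests on a rank factorization: a matrix \<open>A\<close> of rank \<open>r\<close> over \<open>D[x]\<close> can be written
  \<open>A = U V\<close> with inner dimension \<open>r\<close> (in module terms, a saturated submodule of \<open>D[x]\<^sup>n\<close> is free,
  which includes Seshadri's theorem that projective \<open>D[x]\<close>-modules are free). Vanishing of the
  bordered minors gives \<open>h A = U V\<close> for some \<open>h \<noteq> 0\<close>, and \<open>h\<close> is removed one prime at a time. If a
  prime \<open>p\<close> divides \<open>U V\<close> and pairs of ring elements can be reduced modulo \<open>p\<close> by \<open>SL\<^sub>2\<close>, then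
  column operations bring a row of \<open>U\<close> that is nonzero modulo \<open>p\<close> to the form \<open>(0, ..., 0, g)\<close>
  modulo \<open>p\<close>; hence \<open>p\<close> divides the last row of \<open>V\<close>, and one inducts on the inner dimension.
  This applies to all primes of \<open>K[x]\<close>, where \<open>K\<close> is the fraction field of \<open>D\<close>, which leaves a
  factor in \<open>D\<close>, and then to the primes \<open>p\<close> of \<open>D\<close>, because \<open>(D/p)[x]\<close> is Euclidean.

  If \<open>A = U V\<close> is a rank factorization, then \<open>C = V U\<close> has order \<open>rank A\<close> and
  \<open>rank (C\<^sup>k) = rank (A\<^sup>k\<^sup>+\<^sup>1)\<close>. So after \<open>l\<close> such steps the matrix has order \<open>rank (A\<^sup>l)\<close> and rank
  \<open>rank (A\<^sup>l\<^sup>+\<^sup>1)\<close>, and it is nonsingular once these agree.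
\<close>

section \<open>Cancelling scalars in factorizations of fixed inner dimension\<close>

text \<open>The row \<open>(a, b)\<close> times the matrix with columns
  \<open>(\<alpha>, \<beta>)\<close> and \<open>(\<gamma>, \<delta>)\<close> has first entry zero
  modulo \<open>p\<close>. The determinant is one in the ring itself, not just modulo
  \<open>p\<close>, so the inverse operation can be applied exactly to the other factor.\<close>

definition sl2_reducible :: "'a::comm_ring_1 \<Rightarrow> 'a \<Rightarrow> 'a \<Rightarrow> bool" where
  "sl2_reducible p a b \<longleftrightarrow>
     (\<exists>\<alpha> \<beta> \<gamma> \<delta>. \<alpha> * \<delta> - \<beta> * \<gamma> = 1 \<and> p dvd a * \<alpha> + b * \<beta>)"

text \<open>Functions of indices replace matrices, so that single columns and rows can be
  overwritten by function update and the inner dimension can vary in an induction.\<close>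

definition factors_through ::
  "nat \<Rightarrow> nat \<Rightarrow> nat \<Rightarrow> (nat \<Rightarrow> nat \<Rightarrow> 'a::comm_ring_1) \<Rightarrow> bool" where
  "factors_through m n k A \<longleftrightarrow>
     (\<exists>U V. \<forall>i<m. \<forall>j<n. A i j = (\<Sum>t<k. U i t * V t j))"

section \<open>Reduction of pairs over a field and over polynomials over a field\<close>

lemma sl2_reducible_commute:
  assumes "sl2_reducible p a b"
  shows "sl2_reducible p b a"
proof -
  obtain \<alpha> \<beta> \<gamma> \<delta> where "\<alpha> * \<delta> - \<beta> * \<gamma> = 1" "p dvd a * \<alpha> + b * \<beta>"
    using assms by (auto simp: sl2_reducible_def)
  then have "\<beta> * (- \<gamma>) - \<alpha> * (- \<delta>) = 1" "p dvd b * \<beta> + a * \<alpha>"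
    by (simp_all add: algebra_simps)
  then show ?thesis unfolding sl2_reducible_def by blast
qed

lemma sl2_reducible_zero: "sl2_reducible p a 0"
proof -
  have "0 * 0 - 1 * (-1) = (1::'a)" "p dvd a * 0 + 0 * 1" by simp_all
  then show ?thesis unfolding sl2_reducible_def by blast
qed

text \<open>One division step of the Euclidean algorithm: the elementary operation is absorbed by
  passing from \<open>\<beta>\<close> to \<open>\<beta> - q * \<alpha>\<close> and from
  \<open>\<delta>\<close> to \<open>\<delta> - q * \<gamma>\<close>.\<close>

lemma sl2_reducible_add_multiple:
  assumes "sl2_reducible p (a - q * b) b"
  shows "sl2_reducible p a b"
proof -
  obtain \<alpha> \<beta> \<gamma> \<delta> where 1: "\<alpha> * \<delta> - \<beta> * \<gamma> = 1" and 2: "p dvd (a - q * b) * \<alpha> + b * \<beta>"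
    using assms by (auto simp: sl2_reducible_def)
  have "\<alpha> * (\<delta> - q * \<gamma>) - (\<beta> - q * \<alpha>) * \<gamma> = \<alpha> * \<delta> - \<beta> * \<gamma>"
    by (simp add: algebra_simps)
  moreover have "a * \<alpha> + b * (\<beta> - q * \<alpha>) = (a - q * b) * \<alpha> + b * \<beta>"
    by (simp add: algebra_simps)
  ultimately show ?thesis using 1 2 unfolding sl2_reducible_def by metis
qed

lemma sl2_reducible_cong:
  assumes "sl2_reducible p (a - c) b" "p dvd c"
  shows "sl2_reducible p a b"
proof -
  obtain \<alpha> \<beta> \<gamma> \<delta> where 1: "\<alpha> * \<delta> - \<beta> * \<gamma> = 1" and 2: "p dvd (a - c) * \<alpha> + b * \<beta>"
    using assms by (auto simp: sl2_reducible_def)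
  have "a * \<alpha> + b * \<beta> = ((a - c) * \<alpha> + b * \<beta>) + c * \<alpha>"
    by (simp add: algebra_simps)
  then have "p dvd a * \<alpha> + b * \<beta>" using 2 assms(2) by (metis dvd_add dvd_mult2)
  then show ?thesis using 1 unfolding sl2_reducible_def by blast
qed

text \<open>When nonzero residues are invertible, a single step suffices: with \<open>c\<close>
  inverse to \<open>b\<close> modulo \<open>p\<close>, the element \<open>a - a * c * b\<close>
  vanishes modulo \<open>p\<close>.\<close>

lemma sl2_reducible_if_invertible_mod:
  assumes "\<And>c. p dvd c \<or> (\<exists>c'. p dvd c * c' - 1)"
  shows "sl2_reducible p a b"
proof (cases "p dvd b")
  case True
  then have "sl2_reducible p b a"
    using sl2_reducible_cong[of p b b a] sl2_reducible_commute[OF sl2_reducible_zero[of p a]] by simp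
  then show ?thesis by (rule sl2_reducible_commute)
next
  case False
  then obtain c where "p dvd b * c - 1" using assms by blast
  then have "p dvd (b * c - 1) * (- a)" by (rule dvd_mult2)
  then have "p dvd a - a * c * b" by (simp add: algebra_simps)
  then have "sl2_reducible p (a - a * c * b) b"
    using sl2_reducible_cong[of p "a - a * c * b" "a - a * c * b" b]
      sl2_reducible_commute[OF sl2_reducible_zero[of p b]] by simp
  then show ?thesis by (rule sl2_reducible_add_multiple)
qed

lemma sl2_reducible_euclid_step:
  fixes p :: "'a::idom" and a b :: "'a poly"
  assumes inv: "\<And>c. p dvd c \<or> (\<exists>c'. p dvd c * c' - 1)"
    and "l \<le> k" and a: "\<forall>i\<ge>Suc k. coeff a i = 0" and b: "\<forall>i\<ge>Suc l. coeff b i = 0"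
    and smaller_b: "\<And>b'. \<forall>i\<ge>l. coeff b' i = 0 \<Longrightarrow> sl2_reducible [:p:] a b'"
    and smaller_a: "\<And>a'. \<forall>i\<ge>k. coeff a' i = 0 \<Longrightarrow> sl2_reducible [:p:] a' b"
  shows "sl2_reducible [:p:] a b"
proof (cases "p dvd coeff b l")
  case True
  let ?m = "monom (coeff b l) l"
  have "coeff (b - ?m) i = 0" if "i \<ge> l" for i
    using b that by (cases "i = l") auto
  then have "sl2_reducible [:p:] a (b - ?m)" using smaller_b by blast
  moreover have "[:p:] dvd ?m" using True by (auto simp: const_poly_dvd_iff)
  ultimately show ?thesis
    using sl2_reducible_commute sl2_reducible_cong by blast
next
  case False
  then obtain c where c: "p dvd coeff b l * c - 1" using inv by blast
  let ?q = "monom (coeff a k * c) (k - l)"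
  \<comment> \<open>\<open>c\<close> inverts the top coefficient of \<open>b\<close> only modulo
    \<open>p\<close>; \<open>?r\<close> is the resulting error in degree \<open>k\<close>, a
    multiple of \<open>p\<close>.\<close>
  let ?r = "monom (coeff a k - coeff a k * c * coeff b l) k"
  have "coeff (a - ?q * b - ?r) i = 0" if "i \<ge> k" for i
  proof (cases "i = k")
    case True
    then show ?thesis using \<open>l \<le> k\<close> by (simp add: coeff_monom_mult)
  next
    case False
    then have "i \<ge> Suc k" using that by simp
    moreover have "i - (k - l) \<ge> Suc l" using \<open>i \<ge> Suc k\<close> \<open>l \<le> k\<close> by simp
    ultimately have "coeff a i = 0" "coeff b (i - (k - l)) = 0" using a b by blast+
    then show ?thesis using False by (simp add: coeff_monom_mult)
  qed
  then have "sl2_reducible [:p:] (a - ?q * b - ?r) b" using smaller_a by blast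
  moreover have "[:p:] dvd ?r"
  proof -
    have "p dvd (coeff b l * c - 1) * (- coeff a k)" using c by (rule dvd_mult2)
    then have "p dvd coeff a k - coeff a k * c * coeff b l" by (simp add: algebra_simps)
    then show ?thesis by (auto simp: const_poly_dvd_iff)
  qed
  ultimately have "sl2_reducible [:p:] (a - ?q * b) b" by (rule sl2_reducible_cong)
  then show ?thesis by (rule sl2_reducible_add_multiple)
qed

text \<open>The Euclidean algorithm over the residue field of \<open>p\<close>, lifted to the polynomial ring.\<close>

lemma sl2_reducible_const_poly:
  fixes p :: "'a::idom" and a b :: "'a poly"
  assumes inv: "\<And>c. p dvd c \<or> (\<exists>c'. p dvd c * c' - 1)"
  shows "sl2_reducible [:p:] a b"
proof -
  have "sl2_reducible [:p:] a b"
    if "\<forall>i\<ge>k. coeff a i = 0" "\<forall>i\<ge>l. coeff b i = 0" for k l and a b :: "'a poly"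
    using that
  \<comment> \<open>The bounds \<open>k\<close> and \<open>l\<close> are strict, so the value 0
    means the zero polynomial, and every step lowers their sum.\<close>
  proof (induction "k + l" arbitrary: k l a b rule: less_induct)
    case less
    consider "k = 0" | "l = 0" | k' l' where "k = Suc k'" "l = Suc l'"
      by (meson not0_implies_Suc)
    then show ?case
    proof cases
      case 1
      then have "a = 0" using less.prems by (simp add: poly_eq_iff)
      then show ?thesis using sl2_reducible_commute[OF sl2_reducible_zero] by simp
    next
      case 2
      then have "b = 0" using less.prems by (simp add: poly_eq_iff)
      then show ?thesis using sl2_reducible_zero by simp
    next
      case 3
      have smaller_b: "sl2_reducible [:p:] a b'" if "\<forall>i\<ge>l'. coeff b' i = 0" for b'
        by (rule less.hyps[OF _ less.prems(1) that]) (simp add: 3)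
      have smaller_a: "sl2_reducible [:p:] a' b" if "\<forall>i\<ge>k'. coeff a' i = 0" for a'
        by (rule less.hyps[OF _ that less.prems(2)]) (simp add: 3)
      show ?thesis
      proof (cases "l' \<le> k'")
        case True
        then show ?thesis
          using sl2_reducible_euclid_step[OF inv] less.prems smaller_a smaller_b unfolding 3 by blast
      next
        case False
        then have "k' \<le> l'" by simp
        then have "sl2_reducible [:p:] b a"
          using sl2_reducible_euclid_step[OF inv, of k' l' b a] less.prems
            sl2_reducible_commute[OF smaller_a] sl2_reducible_commute[OF smaller_b]
          unfolding 3 by blast
        then show ?thesis by (rule sl2_reducible_commute)
      qed
    qed
  qed
  from this[of "Suc (degree a)" a "Suc (degree b)" b] show ?thesis
    by (simp add: coeff_eq_0)
qed

section \<open>Taking a prime out of a product of matrices\<close>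

text \<open>The entries of row \<open>r\<close> in columns \<open>0, ..., q - 1\<close> are cleared
  modulo \<open>p\<close> one after another, each against the pivot column \<open>k\<close>. Being
  invertible, the operations cannot make the whole row vanish modulo \<open>p\<close>.\<close>

lemma factorization_row_reduce:
  fixes U V :: "nat \<Rightarrow> nat \<Rightarrow> 'a::comm_ring_1"
  assumes red: "\<And>a b. sl2_reducible p a b"
    and nz: "\<exists>t<Suc k. \<not> p dvd U r t" and "q \<le> k"
  shows "\<exists>U' V'. (\<forall>i j. (\<Sum>t<Suc k. U' i t * V' t j) = (\<Sum>t<Suc k. U i t * V t j)) \<and>
     (\<forall>t<q. p dvd U' r t) \<and> (\<exists>t<Suc k. \<not> p dvd U' r t)"
  using \<open>q \<le> k\<close>
proof (induction q)
  case 0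
  then show ?case using nz by blast
next
  case (Suc q)
  then obtain U1 V1 where
    1: "\<And>i j. (\<Sum>t<Suc k. U1 i t * V1 t j) = (\<Sum>t<Suc k. U i t * V t j)"
    and 2: "\<forall>t<q. p dvd U1 r t" and 3: "\<exists>t<Suc k. \<not> p dvd U1 r t"
    by auto
  obtain \<alpha> \<beta> \<gamma> \<delta> where det: "\<alpha> * \<delta> - \<beta> * \<gamma> = 1" and dv: "p dvd U1 r q * \<alpha> + U1 r k * \<beta>"
    using red[of "U1 r q" "U1 r k"] unfolding sl2_reducible_def by blast
  have "q < k" using Suc.prems by simp
  \<comment> \<open>Columns \<open>q\<close> and \<open>k\<close> of \<open>U1\<close> are
    multiplied by the determinant-one matrix, rows \<open>q\<close> and \<open>k\<close> of
    \<open>V1\<close> by its inverse, so the product stays the same.\<close>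
  define U2 where "U2 i = (U1 i)(q := U1 i q * \<alpha> + U1 i k * \<beta>, k := U1 i q * \<gamma> + U1 i k * \<delta>)" for i
  define V2 where "V2 = V1(q := \<lambda>j. \<delta> * V1 q j - \<gamma> * V1 k j, k := \<lambda>j. \<alpha> * V1 k j - \<beta> * V1 q j)"
  have split: "(\<Sum>t<Suc k. f t) = f q + f k + (\<Sum>t\<in>{..<k} - {q}. f t)" for f :: "nat \<Rightarrow> 'a"
    using sum.remove[of "{..<k}" q f] \<open>q < k\<close> by (simp add: algebra_simps)
  have "(\<Sum>t<Suc k. U2 i t * V2 t j) = (\<Sum>t<Suc k. U1 i t * V1 t j)" for i j
  proof -
    have "(\<Sum>t\<in>{..<k} - {q}. U2 i t * V2 t j) = (\<Sum>t\<in>{..<k} - {q}. U1 i t * V1 t j)"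
      by (intro sum.cong) (auto simp: U2_def V2_def)
    moreover have "U2 i q * V2 q j + U2 i k * V2 k j
        = (\<alpha> * \<delta> - \<beta> * \<gamma>) * (U1 i q * V1 q j + U1 i k * V1 k j)"
      using \<open>q < k\<close> by (simp add: U2_def V2_def algebra_simps)
    ultimately show ?thesis unfolding split using det by simp
  qed
  moreover have "p dvd U2 r t" if "t < Suc q" for t
    using that 2 dv \<open>q < k\<close> by (auto simp: U2_def less_Suc_eq)
  moreover have "\<exists>t<Suc k. \<not> p dvd U2 r t"
  proof (rule ccontr)
    assume "\<not> ?thesis"
    then have all: "p dvd U2 r t" if "t < Suc k" for t using that by blast
    have q: "p dvd U1 r q * \<alpha> + U1 r k * \<beta>" and k: "p dvd U1 r q * \<gamma> + U1 r k * \<delta>"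
      using all[of q] all[of k] \<open>q < k\<close> by (simp_all add: U2_def)
    \<comment> \<open>Undoing the operation expresses the old entries by the new ones, so
      \<open>p\<close> would divide all of row \<open>r\<close> of \<open>U1\<close>.\<close>
    have "U1 r q * (\<alpha> * \<delta> - \<beta> * \<gamma>) = (U1 r q * \<alpha> + U1 r k * \<beta>) * \<delta> - (U1 r q * \<gamma> + U1 r k * \<delta>) * \<beta>"
      by (simp add: algebra_simps)
    then have "p dvd U1 r q" using q k det by (metis dvd_diff dvd_mult2 mult.right_neutral)
    moreover have "U1 r k * (\<alpha> * \<delta> - \<beta> * \<gamma>)
        = (U1 r q * \<gamma> + U1 r k * \<delta>) * \<alpha> - (U1 r q * \<alpha> + U1 r k * \<beta>) * \<gamma>"
      by (simp add: algebra_simps)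
    then have "p dvd U1 r k" using q k det by (metis dvd_diff dvd_mult2 mult.right_neutral)
    moreover have "p dvd U1 r t" if "t < Suc k" "t \<noteq> q" "t \<noteq> k" for t
      using all[of t] that by (simp add: U2_def)
    ultimately show False using 3 by metis
  qed
  ultimately show ?case using 1 by (intro exI[of _ U2] exI[of _ V2]) simp
qed

text \<open>If \<open>p\<close> divides the left factor, it is taken out there. Otherwise a row of
  the left factor that is nonzero modulo \<open>p\<close> forces, after reduction, a whole row of
  the right factor to be divisible by \<open>p\<close>, and the remaining \<open>k\<close> columns
  and rows are handled by induction.\<close>

lemma factorization_divide_prime:
  fixes U V :: "nat \<Rightarrow> nat \<Rightarrow> 'a::idom"
  assumes p: "prime_elem p" and red: "\<And>a b. sl2_reducible p a b"
    and "\<And>i j. i < m \<Longrightarrow> j < n \<Longrightarrow> p dvd (\<Sum>t<k. U i t * V t j)"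
  shows "\<exists>U' V'. \<forall>i<m. \<forall>j<n. (\<Sum>t<k. U i t * V t j) = p * (\<Sum>t<k. U' i t * V' t j)"
  using assms(3)
proof (induction k arbitrary: U V)
  case 0
  then show ?case by simp
next
  case (Suc k)
  show ?case
  proof (cases "\<forall>i<m. \<forall>t<Suc k. p dvd U i t")
    case True
    then have "\<forall>i t. \<exists>u. i < m \<longrightarrow> t < Suc k \<longrightarrow> U i t = p * u" by (metis dvdE)
    then obtain U' where "\<And>i t. i < m \<Longrightarrow> t < Suc k \<Longrightarrow> U i t = p * U' i t" by metis
    then have "\<forall>i<m. \<forall>j<n. (\<Sum>t<Suc k. U i t * V t j) = p * (\<Sum>t<Suc k. U' i t * V t j)"
      unfolding sum_distrib_left by (auto intro!: sum.cong simp: mult.assoc simp del: sum.lessThan_Suc)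
    then show ?thesis by blast
  next
    case False
    then obtain r where "r < m" and r: "\<exists>t<Suc k. \<not> p dvd U r t" by blast
    obtain U1 V1 where
      eq: "\<And>i j. (\<Sum>t<Suc k. U1 i t * V1 t j) = (\<Sum>t<Suc k. U i t * V t j)"
      and dv: "\<forall>t<k. p dvd U1 r t" and "\<exists>t<Suc k. \<not> p dvd U1 r t"
      using factorization_row_reduce[of p k U r k V, OF red r] by auto
    then have nk: "\<not> p dvd U1 r k" by (metis less_SucE)
    have "p dvd V1 k j" if "j < n" for j
    proof -
      have "p dvd (\<Sum>t<Suc k. U1 r t * V1 t j)" using Suc.prems \<open>r < m\<close> that eq by metis
      moreover have "p dvd (\<Sum>t<k. U1 r t * V1 t j)" using dv by (auto intro: dvd_sum)
      ultimately have "p dvd U1 r k * V1 k j" by (simp add: dvd_add_right_iff)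
      then show ?thesis using p nk by (auto simp: prime_elem_dvd_mult_iff)
    qed
    then have "\<forall>j. \<exists>w. j < n \<longrightarrow> V1 k j = p * w" by (metis dvdE)
    then obtain w where w: "\<And>j. j < n \<Longrightarrow> V1 k j = p * w j" by metis
    have "p dvd (\<Sum>t<k. U1 i t * V1 t j)" if "i < m" "j < n" for i j
    proof -
      have "p dvd (\<Sum>t<k. U1 i t * V1 t j) + U1 i k * V1 k j"
        using Suc.prems[OF that] eq[of i j] by simp
      then show ?thesis using w that by (simp add: dvd_add_left_iff)
    qed
    from Suc.IH[of U1 V1, OF this] obtain U2 V2 where
      2: "\<forall>i<m. \<forall>j<n. (\<Sum>t<k. U1 i t * V1 t j) = p * (\<Sum>t<k. U2 i t * V2 t j)" by blast
    \<comment> \<open>The last column is kept and the last row of \<open>V1\<close> is replaced by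
      its quotient \<open>w\<close> by \<open>p\<close>; the other columns and rows come from the
      induction hypothesis.\<close>
    define U' where "U' i = (U2 i)(k := U1 i k)" for i
    define V' where "V' = V2(k := w)"
    have "(\<Sum>t<Suc k. U i t * V t j) = p * (\<Sum>t<Suc k. U' i t * V' t j)" if "i < m" "j < n" for i j
    proof -
      have "(\<Sum>t<k. U' i t * V' t j) = (\<Sum>t<k. U2 i t * V2 t j)"
        by (intro sum.cong) (auto simp: U'_def V'_def)
      moreover have "U' i k * V' k j = U1 i k * w j" by (simp add: U'_def V'_def)
      ultimately show ?thesis
        using eq[of i j] 2 w that by (simp add: algebra_simps)
    qed
    then show ?thesis by blast
  qed
qed

corollary factors_through_cancel_prime:
  fixes A :: "nat \<Rightarrow> nat \<Rightarrow> 'a::idom"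
  assumes "prime_elem p" "\<And>a b. sl2_reducible p a b"
    and "factors_through m n k (\<lambda>i j. p * A i j)"
  shows "factors_through m n k A"
proof -
  obtain U V where UV: "\<forall>i<m. \<forall>j<n. p * A i j = (\<Sum>t<k. U i t * V t j)"
    using assms(3) unfolding factors_through_def by blast
  then have "\<And>i j. i < m \<Longrightarrow> j < n \<Longrightarrow> p dvd (\<Sum>t<k. U i t * V t j)" by (metis dvd_triv_left)
  from factorization_divide_prime[where U=U and V=V and m=m and n=n and k=k, OF assms(1,2) this] obtain U' V' where
    "\<forall>i<m. \<forall>j<n. (\<Sum>t<k. U i t * V t j) = p * (\<Sum>t<k. U' i t * V' t j)" by blast
  then have "\<forall>i<m. \<forall>j<n. p * A i j = p * (\<Sum>t<k. U' i t * V' t j)"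
    using UV by simp
  then have "\<forall>i<m. \<forall>j<n. A i j = (\<Sum>t<k. U' i t * V' t j)"
    using \<open>prime_elem p\<close> by auto
  then show ?thesis unfolding factors_through_def by blast
qed

lemma factors_through_cancel_unit:
  fixes A :: "nat \<Rightarrow> nat \<Rightarrow> 'a::comm_ring_1"
  assumes "u dvd 1" and "factors_through m n k (\<lambda>i j. u * A i j)"
  shows "factors_through m n k A"
proof -
  obtain U V where UV: "\<forall>i<m. \<forall>j<n. u * A i j = (\<Sum>t<k. U i t * V t j)"
    using assms(2) unfolding factors_through_def by blast
  obtain v where v: "1 = u * v" using assms(1) by (auto elim: dvdE)
  have "A i j = (\<Sum>t<k. (v * U i t) * V t j)" if "i < m" "j < n" for i j
  proof -
    have "A i j = v * (u * A i j)" using v by (metis mult.assoc mult.commute mult_1)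
    also have "\<dots> = (\<Sum>t<k. (v * U i t) * V t j)"
      using UV that by (simp add: sum_distrib_left mult.assoc)
    finally show ?thesis .
  qed
  then show ?thesis unfolding factors_through_def by (intro exI[of _ "\<lambda>i t. v * U i t"] exI[of _ V]) simp
qed

section \<open>Divisibility in principal ideal domains\<close>

text \<open>The ascending chain condition: the union \<open>I\<close> of the principal ideals of a
  chain is principal, and its generator already lies in one of them, where the chain has to
  stop.\<close>

lemma wf_proper_dvd_pid: "wf {(a, b :: 'a::pid). b \<noteq> 0 \<and> a dvd b \<and> \<not> b dvd a}"
  unfolding wf_iff_no_infinite_down_chain
proof clarify
  fix f :: "nat \<Rightarrow> 'a"
  assume "\<forall>i. (f (Suc i), f i) \<in> {(a, b). b \<noteq> 0 \<and> a dvd b \<and> \<not> b dvd a}"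
  then have step: "f (Suc i) dvd f i" and strict: "\<not> f i dvd f (Suc i)" for i by auto
  have dec: "f j dvd f i" if "i \<le> j" for i j
    using that by (induction j rule: dec_induct) (auto intro: dvd_trans step)
  define I where "I = {x. \<exists>i. f i dvd x}"
  have "0 \<in> I" unfolding I_def by auto
  moreover have "x + y \<in> I" if "x \<in> I" "y \<in> I" for x y
  proof -
    from that have "\<exists>i. f i dvd x" "\<exists>j. f j dvd y" unfolding I_def by simp_all
    then obtain i j where "f i dvd x" "f j dvd y" by blast
    then have "f (max i j) dvd x" "f (max i j) dvd y"
      using dec[of i "max i j"] dec[of j "max i j"] by (auto intro: dvd_trans)
    then show ?thesis unfolding I_def by (auto intro: dvd_add)
  qed
  moreover have "r * x \<in> I" if "x \<in> I" for r x
    using that unfolding I_def by (auto intro: dvd_mult)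
  ultimately obtain g where g: "I = {r * g | r. True}" using every_ideal_principal[of I] by blast
  then have "g \<in> I" by (auto intro: exI[of _ 1])
  then obtain i where "f i dvd g" unfolding I_def by auto
  moreover have "g dvd f (Suc i)"
  proof -
    have "f (Suc i) \<in> I" unfolding I_def using dvd_refl by blast
    then show ?thesis unfolding g by auto
  qed
  ultimately show False using strict dvd_trans by blast
qed

text \<open>The ideal generated by \<open>c\<close> and \<open>p\<close> has a generator
  \<open>g\<close> dividing \<open>p\<close>. By irreducibility \<open>g\<close> is either an
  associate of \<open>p\<close>, which then divides \<open>c\<close>, or a unit, which gives a
  Bezout relation.\<close>

lemma irreducible_pid_invertible_mod:
  fixes p :: "'a::pid"
  assumes "irreducible p"
  shows "p dvd c \<or> (\<exists>c'. p dvd c * c' - 1)"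
proof -
  define I where "I = {x. \<exists>u v. x = u * c + v * p}"
  have "0 \<in> I" unfolding I_def by (auto intro: exI[of _ 0])
  moreover have "x + y \<in> I" if xy: "x \<in> I" "y \<in> I" for x y
  proof -
    obtain u v u' v' where "x = u * c + v * p" "y = u' * c + v' * p" using xy unfolding I_def by auto
    then have "x + y = (u + u') * c + (v + v') * p" by (simp add: algebra_simps)
    then show ?thesis unfolding I_def by blast
  qed
  moreover have "r * x \<in> I" if x: "x \<in> I" for r x
  proof -
    obtain u v where "x = u * c + v * p" using x unfolding I_def by auto
    then have "r * x = (r * u) * c + (r * v) * p" by (simp add: algebra_simps)
    then show ?thesis unfolding I_def by blast
  qed
  ultimately obtain g where g: "I = {r * g | r. True}" using every_ideal_principal[of I] by blast
  have "c \<in> I" unfolding I_def by (auto intro: exI[of _ 1] exI[of _ 0])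
  then have gc: "g dvd c" unfolding g by auto
  have "p \<in> I" unfolding I_def by (intro CollectI exI[of _ 0] exI[of _ 1]) simp
  then obtain e where e: "p = e * g" unfolding g by auto
  with assms consider "e dvd 1" | "g dvd 1" by (auto dest: irreducibleD)
  then show ?thesis
  proof cases
    case 1
    then have "p dvd g" unfolding e by (metis mult.left_neutral mult_dvd_mono dvd_refl)
    then show ?thesis using gc dvd_trans by blast
  next
    case 2
    then obtain s where s: "1 = g * s" by (auto elim: dvdE)
    then have "1 \<in> I" unfolding g by (auto intro: exI[of _ s] simp: mult.commute)
    then obtain u v where "1 = u * c + v * p" unfolding I_def by auto
    then have "c * u - 1 = p * (- v)" by (simp add: algebra_simps)
    then show ?thesis by (metis dvd_triv_left)
  qed
qed

lemma irreducible_pid_prime_elem: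
  fixes p :: "'a::pid"
  assumes "irreducible p"
  shows "prime_elem p"
proof (rule prime_elemI)
  fix a b assume ab: "p dvd a * b"
  show "p dvd a \<or> p dvd b"
  proof (cases "p dvd a")
    case False
    then obtain c where "p dvd a * c - 1" using irreducible_pid_invertible_mod[OF assms] by blast
    then have "p dvd (a * c - 1) * b" by (rule dvd_mult2)
    moreover have "p dvd c * (a * b)" using ab by (rule dvd_mult)
    ultimately have "p dvd c * (a * b) - (a * c - 1) * b" by (rule dvd_diff[rotated])
    then show ?thesis by (simp add: algebra_simps)
  qed simp
qed (use assms in \<open>auto simp: irreducible_def\<close>)

text \<open>A non-unit divisor of \<open>d\<close> that is minimal with respect to divisibility has
  no proper factorization.\<close>

lemma irreducible_divisor_pid:
  fixes d :: "'a::pid"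
  assumes "d \<noteq> 0" "\<not> d dvd 1"
  shows "\<exists>p. irreducible p \<and> p dvd d"
proof -
  let ?Q = "{x. x dvd d \<and> \<not> x dvd 1}"
  have "d \<in> ?Q" using assms by simp
  from wfE_min[OF wf_proper_dvd_pid this] obtain p where "p \<in> ?Q"
    and "\<And>y. (y, p) \<in> {(a, b). b \<noteq> 0 \<and> a dvd b \<and> \<not> b dvd a} \<Longrightarrow> y \<notin> ?Q" by blast
  then have p: "p dvd d" "\<not> p dvd 1"
    and min: "\<And>y. p \<noteq> 0 \<and> y dvd p \<and> \<not> p dvd y \<Longrightarrow> y \<notin> ?Q" by simp_all
  have "p \<noteq> 0" using p assms by auto
  moreover have "a dvd 1 \<or> b dvd 1" if ab: "p = a * b" for a b
  proof (cases "p dvd a")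
    case True
    then obtain c where "a = a * b * c" unfolding ab by (rule dvdE)
    then have "1 = b * c" using \<open>p \<noteq> 0\<close> ab by (metis mult.assoc mult_cancel_left1 mult_zero_left)
    then show ?thesis by (metis dvd_triv_left)
  next
    case False
    then have "a \<notin> ?Q" using min[of a] \<open>p \<noteq> 0\<close> ab by simp
    moreover have "a dvd d" using p(1) ab dvd_mult_left by blast
    ultimately show ?thesis by simp
  qed
  ultimately have "irreducible p" using p by (intro irreducibleI) auto
  then show ?thesis using p by blast
qed

text \<open>Existence of factorizations into irreducibles, in the form of an induction rule: the
  cofactor of an irreducible divisor of \<open>d\<close> is a proper divisor of
  \<open>d\<close>.\<close>

lemma pid_multiplicative_induct [consumes 1, case_names unit mult]:
  fixes d :: "'a::pid"
  assumes "d \<noteq> 0" and "\<And>u. u dvd 1 \<Longrightarrow> P u"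
    and "\<And>p d. irreducible p \<Longrightarrow> P d \<Longrightarrow> P (p * d)"
  shows "P d"
  using \<open>d \<noteq> 0\<close>
proof (induction d rule: wf_induct_rule[OF wf_proper_dvd_pid])
  case (1 d)
  show ?case
  proof (cases "d dvd 1")
    case False
    then obtain p e where p: "irreducible p" and e: "d = p * e"
      using irreducible_divisor_pid[OF 1(2)] by (metis dvdE)
    have "\<not> d dvd e"
    proof
      assume "d dvd e"
      then obtain s where "e = p * e * s" unfolding e by (rule dvdE)
      then have "1 = p * s" using 1(2) e by (metis mult.assoc mult.commute mult_cancel_left1 mult_zero_right)
      then show False using p by (metis dvd_triv_left irreducible_not_unit)
    qed
    then have "P e" using 1 e by auto
    then show ?thesis using assms(3) p e by blast
  qed (use assms(2) in blast)
qed

text \<open>Makes the results on principal ideal domains available for polynomials over the fraction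
  field. A nonzero element of least degree generates the ideal, by division with remainder.\<close>

instance poly :: (field) pid
proof
  fix I :: "'a poly set"
  assume I: "0 \<in> I" "\<forall>x\<in>I. \<forall>y\<in>I. x + y \<in> I" "\<forall>r. \<forall>x\<in>I. r * x \<in> I"
  show "\<exists>g. I = {r * g | r. True}"
  proof (cases "I = {0}")
    case True
    then show ?thesis by (intro exI[of _ 0]) auto
  next
    case False
    then obtain f where f: "f \<in> I \<and> f \<noteq> 0" using I(1) by blast
    define g where "g = arg_min degree (\<lambda>x. x \<in> I \<and> x \<noteq> 0)"
    have g: "g \<in> I \<and> g \<noteq> 0" unfolding g_def by (rule arg_min_natI) (rule f)
    have min: "degree g \<le> degree x" if "x \<in> I" "x \<noteq> 0" for x
      unfolding g_def by (rule arg_min_nat_le) (use that in blast)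
    have "\<exists>r. x = r * g" if "x \<in> I" for x
    proof -
      have "x mod g = x + (- (x div g)) * g" by (simp add: minus_div_mult_eq_mod [symmetric])
      then have "x mod g \<in> I" using I(2,3) g that by metis
      then have "x mod g = 0" using min degree_mod_less[of g x] g by force
      then show ?thesis by (metis dvd_div_mult_self mod_0_imp_dvd)
    qed
    then show ?thesis using I(3) g by (intro exI[of _ g]) auto
  qed
qed

text \<open>The irreducible factors of \<open>d\<close> are cancelled one at a time; the residue
  ring of each is a field, so pairs reduce by one inversion.\<close>

lemma factors_through_cancel_pid:
  fixes A :: "nat \<Rightarrow> nat \<Rightarrow> 'a::pid"
  assumes "d \<noteq> 0" and "factors_through m n k (\<lambda>i j. d * A i j)"
  shows "factors_through m n k A"
  using assms
proof (induction d arbitrary: A rule: pid_multiplicative_induct)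
  case (unit u)
  then show ?case by (rule factors_through_cancel_unit)
next
  case (mult p d)
  have "factors_through m n k (\<lambda>i j. p * (d * A i j))" using mult.prems by (simp add: mult.assoc)
  then have "factors_through m n k (\<lambda>i j. d * A i j)"
    by (rule factors_through_cancel_prime[OF irreducible_pid_prime_elem[OF mult.hyps]
          sl2_reducible_if_invertible_mod[OF irreducible_pid_invertible_mod[OF mult.hyps]]])
  then show ?case by (rule mult.IH)
qed

text \<open>Irreducibles of the coefficient ring stay prime as constant polynomials. The quotient is
  now a polynomial ring over a field, so pairs are reduced by the Euclidean algorithm.\<close>

lemma factors_through_cancel_const_poly:
  fixes A :: "nat \<Rightarrow> nat \<Rightarrow> 'a::pid poly"
  assumes "d \<noteq> 0" and "factors_through m n k (\<lambda>i j. [:d:] * A i j)"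
  shows "factors_through m n k A"
  using assms
proof (induction d arbitrary: A rule: pid_multiplicative_induct)
  case (unit u)
  have "[:u:] dvd 1" using unit(1) by (simp add: is_unit_const_poly_iff)
  then show ?case using unit(2) by (rule factors_through_cancel_unit)
next
  case (mult p d)
  have "factors_through m n k (\<lambda>i j. [:p:] * ([:d:] * A i j))"
    using mult.prems by (simp add: mult.commute)
  moreover have "prime_elem [:p:]"
    using irreducible_pid_prime_elem[OF mult.hyps] by (simp add: prime_elem_const_poly_iff)
  ultimately have "factors_through m n k (\<lambda>i j. [:d:] * A i j)"
    by (intro factors_through_cancel_prime[where p="[:p:]" and A="\<lambda>i j. [:d:] * A i j"]
        sl2_reducible_const_poly irreducible_pid_invertible_mod mult.hyps)
  then show ?case by (rule mult.IH)
qed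

section \<open>Descent from the fraction field\<close>

lemma common_denominator_fract:
  fixes S :: "'a::idom fract set"
  assumes "finite S"
  shows "\<exists>d. d \<noteq> 0 \<and> (\<forall>x\<in>S. \<exists>a. to_fract d * x = to_fract a)"
  using assms
proof (induction S)
  case empty
  show ?case by (intro exI[of _ 1]) simp
next
  case (insert x S)
  then obtain d where d: "d \<noteq> 0" "\<forall>x\<in>S. \<exists>a. to_fract d * x = to_fract a" by blast
  obtain a b where x: "x = Fract a b" "b \<noteq> 0" by (cases x)
  then have "to_fract b * x = to_fract a" by (simp add: Fract_conv_to_fract)
  then have "to_fract (d * b) * x = to_fract (d * a)" by (simp add: mult.assoc)
  moreover have "\<exists>a. to_fract (d * b) * y = to_fract a" if y: "y \<in> S" for y
  proof -
    obtain c where "to_fract d * y = to_fract c" using d y by blast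
    then have "to_fract (d * b) * y = to_fract (b * c)" by (simp add: ac_simps)
    then show ?thesis by blast
  qed
  ultimately show ?case using d(1) x(2) by (metis insert_iff mult_eq_0_iff)
qed

lemma common_denominator_fract_poly:
  fixes S :: "'a::idom fract poly set"
  assumes "finite S"
  shows "\<exists>d. d \<noteq> 0 \<and> (\<forall>f\<in>S. \<exists>g. smult (to_fract d) f = fract_poly g)"
proof -
  have "finite (\<Union>f\<in>S. set (coeffs f))" using assms by simp
  from common_denominator_fract[OF this] obtain d where d: "d \<noteq> 0"
    and c: "\<And>f x. f \<in> S \<Longrightarrow> x \<in> set (coeffs f) \<Longrightarrow> \<exists>a. to_fract d * x = to_fract a" by blast
  have "\<exists>g. smult (to_fract d) f = fract_poly g" if "f \<in> S" for f
  proof -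
    have "\<exists>a. to_fract d * coeff f i = to_fract a" for i
    proof (cases "coeff f i = 0")
      case True
      then show ?thesis by (intro exI[of _ 0]) simp
    next
      case False
      then show ?thesis using c[OF that] coeff_in_coeffs[of f i] le_degree[of f i] by force
    qed
    then obtain a where a: "\<And>i. to_fract d * coeff f i = to_fract (a i)" by metis
    define g where "g = (\<Sum>i\<le>degree f. monom (a i) i)"
    have "a i = 0" if "i > degree f" for i using a[of i] that by (simp add: coeff_eq_0)
    then have "coeff g i = a i" for i
      unfolding g_def by (cases "i \<le> degree f") (auto simp: coeff_sum)
    then have "smult (to_fract d) f = fract_poly g"
      by (simp add: poly_eq_iff coeff_map_poly a)
    then show ?thesis by blast
  qed
  then show ?thesis using d by blast
qed

lemma fract_poly_sum: "fract_poly (sum f S) = (\<Sum>x\<in>S. fract_poly (f x))"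
  by (induction S rule: infinite_finite_induct) simp_all

lemma smult_sum_right: "smult c (sum f S) = (\<Sum>x\<in>S. smult c (f x))"
  by (induction S rule: infinite_finite_induct) (simp_all add: smult_add_right)

text \<open>The two factors are cleared of denominators separately. Denominators come from
  coefficients, so the price is a constant polynomial.\<close>

lemma factors_through_fract_poly:
  fixes A :: "nat \<Rightarrow> nat \<Rightarrow> 'a::idom poly"
  assumes "factors_through m n k (\<lambda>i j. fract_poly (A i j))"
  shows "\<exists>d. d \<noteq> 0 \<and> factors_through m n k (\<lambda>i j. [:d:] * A i j)"
proof -
  obtain U V where UV: "\<And>i j. i < m \<Longrightarrow> j < n \<Longrightarrow> fract_poly (A i j) = (\<Sum>t<k. U i t * V t j)"
    using assms unfolding factors_through_def by blast
  have "finite ((\<lambda>(i, t). U i t) ` ({..<m} \<times> {..<k}))" by simp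
  from common_denominator_fract_poly[OF this] obtain d where d: "d \<noteq> 0"
    and "\<forall>i t. \<exists>g. i < m \<longrightarrow> t < k \<longrightarrow> smult (to_fract d) (U i t) = fract_poly g" by fast
  then obtain U' where U': "\<And>i t. i < m \<Longrightarrow> t < k \<Longrightarrow> smult (to_fract d) (U i t) = fract_poly (U' i t)"
    by metis
  have "finite ((\<lambda>(t, j). V t j) ` ({..<k} \<times> {..<n}))" by simp
  from common_denominator_fract_poly[OF this] obtain e where e: "e \<noteq> 0"
    and "\<forall>t j. \<exists>g. t < k \<longrightarrow> j < n \<longrightarrow> smult (to_fract e) (V t j) = fract_poly g" by fast
  then obtain V' where V': "\<And>t j. t < k \<Longrightarrow> j < n \<Longrightarrow> smult (to_fract e) (V t j) = fract_poly (V' t j)"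
    by metis
  have "[:d * e:] * A i j = (\<Sum>t<k. U' i t * V' t j)" if "i < m" "j < n" for i j
  proof -
    have "fract_poly ([:d * e:] * A i j) = smult (to_fract d * to_fract e) (fract_poly (A i j))"
      by (simp add: mult.commute)
    also have "\<dots> = (\<Sum>t<k. smult (to_fract d) (U i t) * smult (to_fract e) (V t j))"
      by (simp add: UV[OF that] smult_sum_right mult.commute)
    also have "\<dots> = (\<Sum>t<k. fract_poly (U' i t) * fract_poly (V' t j))"
      using that by (intro sum.cong) (simp_all add: U' V')
    also have "\<dots> = fract_poly (\<Sum>t<k. U' i t * V' t j)" by (simp add: fract_poly_sum)
    finally show ?thesis by (simp only: fract_poly_eq_iff)
  qed
  then show ?thesis using d e unfolding factors_through_def by (intro exI[of _ "d * e"]) auto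
qed

text \<open>Over the fraction field the polynomial ring is a principal ideal domain, so
  \<open>h\<close> cancels there; returning costs a constant \<open>d\<close>, which cancels over
  the original ring.\<close>

theorem factors_through_cancel_poly:
  fixes A :: "nat \<Rightarrow> nat \<Rightarrow> 'a::pid poly"
  assumes "h \<noteq> 0" and "factors_through m n k (\<lambda>i j. h * A i j)"
  shows "factors_through m n k A"
proof -
  obtain U V where UV: "\<And>i j. i < m \<Longrightarrow> j < n \<Longrightarrow> h * A i j = (\<Sum>t<k. U i t * V t j)"
    using assms(2) unfolding factors_through_def by blast
  have "fract_poly h * fract_poly (A i j) = (\<Sum>t<k. fract_poly (U i t) * fract_poly (V t j))"
    if "i < m" "j < n" for i j
    using arg_cong[OF UV[OF that], of fract_poly] by (simp add: fract_poly_sum)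
  then have "factors_through m n k (\<lambda>i j. fract_poly h * fract_poly (A i j))"
    unfolding factors_through_def
    by (intro exI[of _ "\<lambda>i t. fract_poly (U i t)"] exI[of _ "\<lambda>t j. fract_poly (V t j)"]) simp
  moreover have "fract_poly h \<noteq> 0" using assms(1) by simp
  ultimately have "factors_through m n k (\<lambda>i j. fract_poly (A i j))"
    by (rule factors_through_cancel_pid[rotated])
  then show ?thesis
    using factors_through_fract_poly[of m n k A] factors_through_cancel_const_poly[of _ m n k A] by blast
qed

section \<open>Minors and rank\<close>

text \<open>Rank over the fraction field, with the denominators cleared.\<close>

definition rank_le :: "'a::idom mat \<Rightarrow> nat \<Rightarrow> bool" where
  "rank_le A k \<longleftrightarrow> (\<exists>h U V. h \<noteq> 0 \<and> U \<in> carrier_mat (dim_row A) k \<and>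
     V \<in> carrier_mat k (dim_col A) \<and> h \<cdot>\<^sub>m A = U * V)"

text \<open>The index maps need be neither increasing nor injective, so a minor can be bordered by a
  further row and column without sorting index sets.\<close>

definition index_minor :: "'a::comm_ring_1 mat \<Rightarrow> nat \<Rightarrow> (nat \<Rightarrow> nat) \<Rightarrow> (nat \<Rightarrow> nat) \<Rightarrow> 'a mat" where
  "index_minor A k f g = mat k k (\<lambda>(i, j). A $$ (f i, g j))"

definition row_selection :: "nat \<Rightarrow> nat \<Rightarrow> (nat \<Rightarrow> nat) \<Rightarrow> 'a::comm_ring_1 mat" where
  "row_selection k m f = mat k m (\<lambda>(i, a). if a = f i then 1 else 0)"

definition col_selection :: "nat \<Rightarrow> nat \<Rightarrow> (nat \<Rightarrow> nat) \<Rightarrow> 'a::comm_ring_1 mat" where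
  "col_selection n k g = mat n k (\<lambda>(b, j). if b = g j then 1 else 0)"

section \<open>Minors of products\<close>

lemma selection_carrier [simp]:
  "row_selection k m f \<in> carrier_mat k m" "col_selection n k g \<in> carrier_mat n k"
  by (simp_all add: row_selection_def col_selection_def)

lemma row_selection_mult:
  assumes "A \<in> carrier_mat m n" "\<And>i. i < k \<Longrightarrow> f i < m"
  shows "row_selection k m f * A = mat k n (\<lambda>(i, j). A $$ (f i, j))"
proof (rule eq_matI)
  fix i j assume ij: "i < dim_row (mat k n (\<lambda>(i, j). A $$ (f i, j)))" "j < dim_col (mat k n (\<lambda>(i, j). A $$ (f i, j)))"
  then have "(row_selection k m f * A) $$ (i, j)
      = (\<Sum>a\<in>{0..<m}. (if a = f i then 1 else 0) * A $$ (a, j))"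
    using assms(1) by (simp add: row_selection_def scalar_prod_def)
  also have "\<dots> = (\<Sum>a\<in>{0..<m}. if a = f i then A $$ (a, j) else 0)"
    by (intro sum.cong) auto
  also have "\<dots> = A $$ (f i, j)" using assms(2)[of i] ij by simp
  finally show "(row_selection k m f * A) $$ (i, j) = mat k n (\<lambda>(i, j). A $$ (f i, j)) $$ (i, j)"
    using ij by simp
qed (use assms in \<open>auto simp: row_selection_def\<close>)

lemma mult_col_selection:
  assumes "A \<in> carrier_mat m n" "\<And>j. j < k \<Longrightarrow> g j < n"
  shows "A * col_selection n k g = mat m k (\<lambda>(i, j). A $$ (i, g j))"
proof (rule eq_matI)
  fix i j assume ij: "i < dim_row (mat m k (\<lambda>(i, j). A $$ (i, g j)))" "j < dim_col (mat m k (\<lambda>(i, j). A $$ (i, g j)))"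
  then have "(A * col_selection n k g) $$ (i, j)
      = (\<Sum>b\<in>{0..<n}. A $$ (i, b) * (if b = g j then 1 else 0))"
    using assms(1) by (simp add: col_selection_def scalar_prod_def)
  also have "\<dots> = (\<Sum>b\<in>{0..<n}. if b = g j then A $$ (i, b) else 0)"
    by (intro sum.cong) auto
  also have "\<dots> = A $$ (i, g j)" using assms(2)[of j] ij by simp
  finally show "(A * col_selection n k g) $$ (i, j) = mat m k (\<lambda>(i, j). A $$ (i, g j)) $$ (i, j)"
    using ij by simp
qed (use assms in \<open>auto simp: col_selection_def\<close>)

lemma index_minor_eq_selection:
  assumes A: "A \<in> carrier_mat m n" and "\<And>i. i < k \<Longrightarrow> f i < m" "\<And>j. j < k \<Longrightarrow> g j < n"
  shows "index_minor A k f g = row_selection k m f * A * col_selection n k g"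
proof -
  have "row_selection k m f * A * col_selection n k g
      = mat k k (\<lambda>(i, j). mat k n (\<lambda>(i, j). A $$ (f i, j)) $$ (i, g j))"
    using assms by (subst row_selection_mult[OF A]) (auto intro: mult_col_selection)
  also have "\<dots> = index_minor A k f g"
    using assms by (auto simp: index_minor_def intro!: eq_matI)
  finally show ?thesis by simp
qed

text \<open>Selecting rows concerns only the left factor and selecting columns only the right one,
  so a minor of a product is a product through the same inner dimension \<open>s\<close>.\<close>

lemma index_minor_mult:
  assumes U: "U \<in> carrier_mat m s" and V: "V \<in> carrier_mat s n"
    and "\<And>i. i < k \<Longrightarrow> f i < m" "\<And>j. j < k \<Longrightarrow> g j < n"
  shows "index_minor (U * V) k f g = (row_selection k m f * U) * (V * col_selection n k g)"
proof -
  have "index_minor (U * V) k f g = row_selection k m f * (U * V) * col_selection n k g"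
    using assms by (intro index_minor_eq_selection) auto
  also have "\<dots> = (row_selection k m f * U) * V * col_selection n k g"
    using U V by (subst assoc_mult_mat[of _ k m _ s _ n]) auto
  also have "\<dots> = (row_selection k m f * U) * (V * col_selection n k g)"
    using mult_carrier_mat[OF selection_carrier(1) U] V
    by (intro assoc_mult_mat[of _ k s _ n _ k]) auto
  finally show ?thesis .
qed

text \<open>Here both selection matrices are square, so the minor is a multiple of
  \<open>det N\<close>.\<close>

lemma det_index_minor_square:
  assumes N: "N \<in> carrier_mat k k" and "\<And>i. i < k \<Longrightarrow> f i < k" "\<And>j. j < k \<Longrightarrow> g j < k"
    and "det (index_minor N k f g) \<noteq> 0"
  shows "det N \<noteq> 0"
proof
  assume "det N = 0"
  have "index_minor N k f g = row_selection k k f * N * col_selection k k g"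
    using assms by (intro index_minor_eq_selection)
  then have "det (index_minor N k f g) = det (row_selection k k f) * det N * det (col_selection k k g)"
    using N mult_carrier_mat[OF selection_carrier(1)[of k k f] N]
    by (simp add: det_mult[of _ k])
  with \<open>det N = 0\<close> assms(4) show False by simp
qed

text \<open>Padding with zeros makes both factors square without changing the product; column
  \<open>k\<close> of the padded left factor is zero.\<close>

lemma det_mult_thin:
  fixes X Y :: "'a::comm_ring_1 mat"
  assumes X: "X \<in> carrier_mat r k" and Y: "Y \<in> carrier_mat k r" and "k < r"
  shows "det (X * Y) = 0"
proof -
  define X' where "X' = mat r r (\<lambda>(i, j). if j < k then X $$ (i, j) else 0)"
  define Y' where "Y' = mat r r (\<lambda>(i, j). if i < k then Y $$ (i, j) else 0)"
  have C: "X' \<in> carrier_mat r r" "Y' \<in> carrier_mat r r" by (auto simp: X'_def Y'_def)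
  have "X * Y = X' * Y'"
  proof (rule eq_matI)
    fix i j assume "i < dim_row (X' * Y')" "j < dim_col (X' * Y')"
    then have ij: "i < r" "j < r" using C by auto
    have "(X' * Y') $$ (i, j)
        = (\<Sum>t\<in>{0..<r}. (if t < k then X $$ (i, t) else 0) * (if t < k then Y $$ (t, j) else 0))"
      using ij by (simp add: X'_def Y'_def scalar_prod_def)
    also have "\<dots> = (\<Sum>t\<in>{0..<k}. X $$ (i, t) * Y $$ (t, j))"
      using \<open>k < r\<close> by (intro sum.mono_neutral_cong_right) auto
    also have "\<dots> = (X * Y) $$ (i, j)" using X Y ij by (simp add: scalar_prod_def)
    finally show "(X * Y) $$ (i, j) = (X' * Y') $$ (i, j)" by simp
  qed (use X Y C in auto)
  moreover have "det X' = 0"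
    using laplace_expansion_column[OF C(1) \<open>k < r\<close>] \<open>k < r\<close> by (simp add: X'_def)
  ultimately show ?thesis using det_mult[OF C] by simp
qed

lemma submatrix_eq_index_minor:
  assumes A: "A \<in> carrier_mat m n" and I: "I \<subseteq> {..<m}" "card I = k" and J: "J \<subseteq> {..<n}" "card J = k"
  shows "submatrix A I J = index_minor A k (pick I) (pick J)"
    and "\<And>i. i < k \<Longrightarrow> pick I i < m" and "\<And>j. j < k \<Longrightarrow> pick J j < n"
proof -
  have "{i. i < m \<and> i \<in> I} = I" "{j. j < n \<and> j \<in> J} = J" using I J by auto
  then show "submatrix A I J = index_minor A k (pick I) (pick J)"
    using A I J by (simp add: submatrix_def index_minor_def)
  show "pick I i < m" if "i < k" for i using pick_in_set_le[of i I] that I by auto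
  show "pick J j < n" if "j < k" for j using pick_in_set_le[of j J] that J by auto
qed

section \<open>Rank by minors versus rank by factorization\<close>

lemma minor_rank_set_finite:
  "finite {k. \<exists>I J. I \<subseteq> {..<dim_row A} \<and> J \<subseteq> {..<dim_col A} \<and>
       card I = k \<and> card J = k \<and> det (submatrix A I J) \<noteq> 0}"
proof (rule finite_subset)
  show "{k. \<exists>I J. I \<subseteq> {..<dim_row A} \<and> J \<subseteq> {..<dim_col A} \<and>
       card I = k \<and> card J = k \<and> det (submatrix A I J) \<noteq> 0} \<subseteq> {..dim_row A}"
    using card_mono[of "{..<dim_row A}"] by auto
qed simp

lemma minor_rank_attained:
  fixes A :: "'a::comm_ring_1 mat"
  assumes A: "A \<in> carrier_mat m n"
  obtains f g where "\<And>i. i < minor_rank A \<Longrightarrow> f i < m" "\<And>j. j < minor_rank A \<Longrightarrow> g j < n"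
    "det (index_minor A (minor_rank A) f g) \<noteq> 0"
proof -
  let ?S = "{k. \<exists>I J. I \<subseteq> {..<dim_row A} \<and> J \<subseteq> {..<dim_col A} \<and>
       card I = k \<and> card J = k \<and> det (submatrix A I J) \<noteq> 0}"
  \<comment> \<open>The empty minor is 1, so the set under \<open>Max\<close> is nonempty for every
    matrix, including zero and empty ones.\<close>
  have "det (submatrix A {} {}) = 1" by (simp add: submatrix_def)
  then have "0 \<in> ?S" by (intro CollectI exI[of _ "{}"]) simp
  then have "minor_rank A \<in> ?S"
    unfolding minor_rank_def using minor_rank_set_finite[of A] by (intro Max_in) auto
  then obtain I J where IJ: "I \<subseteq> {..<m}" "card I = minor_rank A" "J \<subseteq> {..<n}" "card J = minor_rank A"
    and "det (submatrix A I J) \<noteq> 0" using A by auto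
  then show thesis
    using that[of "pick I" "pick J"] submatrix_eq_index_minor[OF A IJ] by simp
qed

text \<open>A repeated index would give two equal rows or columns, so \<open>f\<close> and
  \<open>g\<close> are injective. Their minor is then an index minor of the sorted submatrix on the
  images, whose determinant must be nonzero too.\<close>

lemma minor_rank_ge:
  fixes A :: "'a::comm_ring_1 mat"
  assumes A: "A \<in> carrier_mat m n"
    and f: "\<And>i. i < k \<Longrightarrow> f i < m" and g: "\<And>j. j < k \<Longrightarrow> g j < n"
    and nz: "det (index_minor A k f g) \<noteq> 0"
  shows "k \<le> minor_rank A"
proof -
  have "inj_on f {..<k}"
  proof (rule inj_onI, rule ccontr)
    fix a b assume ab: "a \<in> {..<k}" "b \<in> {..<k}" "f a = f b" "a \<noteq> b"
    have "row (index_minor A k f g) a = row (index_minor A k f g) b"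
      using ab by (auto simp: index_minor_def)
    then have "det (index_minor A k f g) = 0"
      using ab by (intro det_identical_rows[of _ k a b]) (auto simp: index_minor_def)
    with nz show False by simp
  qed
  moreover have "inj_on g {..<k}"
  proof (rule inj_onI, rule ccontr)
    fix a b assume ab: "a \<in> {..<k}" "b \<in> {..<k}" "g a = g b" "a \<noteq> b"
    have "col (index_minor A k f g) a = col (index_minor A k f g) b"
      using ab by (auto simp: index_minor_def)
    then have "det (index_minor A k f g) = 0"
      using ab by (intro det_identical_columns[of _ k a b]) (auto simp: index_minor_def)
    with nz show False by simp
  qed
  ultimately have card: "card (f ` {..<k}) = k" "card (g ` {..<k}) = k" by (auto simp: card_image)
  have sub: "f ` {..<k} \<subseteq> {..<m}" "g ` {..<k} \<subseteq> {..<n}" using f g by auto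
  let ?I = "f ` {..<k}" and ?J = "g ` {..<k}"
  \<comment> \<open>The position of \<open>f i\<close> in the increasing enumeration of the image,
    which is how \<open>pick\<close> recovers it.\<close>
  define \<pi> where "\<pi> i = card {a \<in> ?I. a < f i}" for i
  define \<rho> where "\<rho> j = card {a \<in> ?J. a < g j}" for j
  have pi: "pick ?I (\<pi> i) = f i" "\<pi> i < k" if "i < k" for i
  proof -
    show "pick ?I (\<pi> i) = f i" unfolding \<pi>_def using that by (intro pick_card_in_set) auto
    have "{a \<in> ?I. a < f i} \<subset> ?I" using that by blast
    then show "\<pi> i < k" unfolding \<pi>_def using card(1) by (metis finite_imageI finite_lessThan psubset_card_mono)
  qed
  have rho: "pick ?J (\<rho> j) = g j" "\<rho> j < k" if "j < k" for j
  proof -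
    show "pick ?J (\<rho> j) = g j" unfolding \<rho>_def using that by (intro pick_card_in_set) auto
    have "{a \<in> ?J. a < g j} \<subset> ?J" using that by blast
    then show "\<rho> j < k" unfolding \<rho>_def using card(2) by (metis finite_imageI finite_lessThan psubset_card_mono)
  qed
  note S = submatrix_eq_index_minor(1)[OF A sub(1) card(1) sub(2) card(2)]
  have "index_minor (submatrix A ?I ?J) k \<pi> \<rho> = index_minor A k f g"
    unfolding S using pi rho by (auto simp: index_minor_def intro!: eq_matI)
  then have "det (index_minor (submatrix A ?I ?J) k \<pi> \<rho>) \<noteq> 0" using nz by simp
  moreover have "submatrix A ?I ?J \<in> carrier_mat k k" unfolding S by (simp add: index_minor_def)
  ultimately have "det (submatrix A ?I ?J) \<noteq> 0"
    using pi(2) rho(2) det_index_minor_square by blast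
  moreover have "?I \<subseteq> {..<dim_row A}" "?J \<subseteq> {..<dim_col A}" using A sub by auto
  ultimately show ?thesis unfolding minor_rank_def
    using card by (intro Max_ge[OF minor_rank_set_finite]) blast
qed

text \<open>A minor of order \<open>r > k\<close> of \<open>h A\<close> is the determinant of a
  product through dimension \<open>k\<close>, hence zero; it is also \<open>h\<close> to the power
  \<open>r\<close> times the corresponding minor of \<open>A\<close>.\<close>

lemma minor_rank_le_if_rank_le:
  fixes A :: "'a::idom mat"
  assumes "rank_le A k"
  shows "minor_rank A \<le> k"
proof (rule ccontr)
  let ?r = "minor_rank A" and ?m = "dim_row A" and ?n = "dim_col A"
  assume "\<not> ?thesis"
  then have less: "k < ?r" by simp
  obtain h U V where h: "h \<noteq> 0" and U: "U \<in> carrier_mat ?m k" and V: "V \<in> carrier_mat k ?n"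
    and UV: "h \<cdot>\<^sub>m A = U * V" using assms unfolding rank_le_def by blast
  obtain f g where f: "\<And>i. i < ?r \<Longrightarrow> f i < ?m" and g: "\<And>j. j < ?r \<Longrightarrow> g j < ?n"
    and nz: "det (index_minor A ?r f g) \<noteq> 0" using minor_rank_attained[of A ?m ?n] by blast
  have "h \<cdot>\<^sub>m index_minor A ?r f g = index_minor (U * V) ?r f g"
    unfolding UV[symmetric] using f g by (auto simp: index_minor_def intro!: eq_matI)
  also have "\<dots> = (row_selection ?r ?m f * U) * (V * col_selection ?n ?r g)"
    using f g by (intro index_minor_mult[OF U V]) auto
  also have "det \<dots> = 0"
    using mult_carrier_mat[OF selection_carrier(1) U] mult_carrier_mat[OF V selection_carrier(2)] less
    by (intro det_mult_thin[of _ ?r k]) auto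
  finally show False using h nz by simp
qed

text \<open>The Schur complement of \<open>N\<close> vanishes, stated without inverses by means of
  the adjugate.\<close>

lemma bordered_minor_zero:
  fixes N b c a :: "'a::idom mat"
  assumes N: "N \<in> carrier_mat r r" and b: "b \<in> carrier_mat r 1" and c: "c \<in> carrier_mat 1 r"
    and a: "a \<in> carrier_mat 1 1" and nz: "det N \<noteq> 0" and zero: "det (four_block_mat N b c a) = 0"
  shows "det N * a $$ (0, 0) = (c * adj_mat N * b) $$ (0, 0)"
proof -
  note adj = adj_mat[OF N]
  \<comment> \<open>Block elimination with the adjugate in place of the inverse of \<open>N\<close>:
    the product with \<open>?T\<close> is block lower triangular, with diagonal blocks
    \<open>det N\<close> times the identity and the scaled Schur complement
    \<open>?E\<close>.\<close>
  let ?T = "four_block_mat (adj_mat N) (- (adj_mat N * b)) (0\<^sub>m 1 r) (det N \<cdot>\<^sub>m 1\<^sub>m 1)"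
  let ?E = "c * (- (adj_mat N * b)) + a * (det N \<cdot>\<^sub>m 1\<^sub>m 1)"
  have ab: "adj_mat N * b \<in> carrier_mat r 1" using adj(1) b by simp
  have T: "?T \<in> carrier_mat (r + 1) (r + 1)" using adj(1) by auto
  have M: "four_block_mat N b c a \<in> carrier_mat (r + 1) (r + 1)" using N a by auto
  have "four_block_mat N b c a * ?T
     = four_block_mat (N * adj_mat N + b * 0\<^sub>m 1 r) (N * (- (adj_mat N * b)) + b * (det N \<cdot>\<^sub>m 1\<^sub>m 1))
         (c * adj_mat N + a * 0\<^sub>m 1 r) ?E"
    using N b c a adj(1) ab by (intro mult_four_block_mat[of _ r r _ 1 _ 1]) auto
  also have "N * (- (adj_mat N * b)) + b * (det N \<cdot>\<^sub>m 1\<^sub>m 1) = 0\<^sub>m r 1"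
  proof -
    have "N * (adj_mat N * b) = det N \<cdot>\<^sub>m b"
      using assoc_mult_mat[OF N adj(1) b] adj(2) b by (simp add: mult_smult_assoc_mat[of _ r r])
    then have "N * (- (adj_mat N * b)) = - (det N \<cdot>\<^sub>m b)"
      by (metis N ab carrier_matD uminus_mult_right_mat)
    moreover have "b * (det N \<cdot>\<^sub>m 1\<^sub>m 1) = det N \<cdot>\<^sub>m b"
      using b mult_smult_distrib[OF b, of "1\<^sub>m 1" 1 "det N"] by simp
    ultimately show ?thesis using b by (auto intro!: eq_matI)
  qed
  also have "N * adj_mat N + b * 0\<^sub>m 1 r = det N \<cdot>\<^sub>m 1\<^sub>m r" using adj(2) b by simp
  finally have "four_block_mat N b c a * ?T
     = four_block_mat (det N \<cdot>\<^sub>m 1\<^sub>m r) (0\<^sub>m r 1) (c * adj_mat N + a * 0\<^sub>m 1 r) ?E" .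
  moreover have "det (four_block_mat (det N \<cdot>\<^sub>m 1\<^sub>m r) (0\<^sub>m r 1) (c * adj_mat N + a * 0\<^sub>m 1 r) ?E)
      = det (det N \<cdot>\<^sub>m 1\<^sub>m r) * det ?E"
    using c a adj(1) ab by (intro det_four_block_mat_upper_right_zero_col) auto
  ultimately have "det N ^ r * det ?E = 0" using det_mult[OF M T] zero by simp
  then have "det ?E = 0" using nz by simp
  moreover have "det ?E = ?E $$ (0, 0)"
    using c a ab by (intro det_single) auto
  moreover have "?E $$ (0, 0) = - (c * adj_mat N * b) $$ (0, 0) + det N * a $$ (0, 0)"
  proof -
    have "c * (- (adj_mat N * b)) = - (c * adj_mat N * b)"
      unfolding assoc_mult_mat[OF c adj(1) b] by (metis c ab carrier_matD uminus_mult_right_mat)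
    moreover have "a * (det N \<cdot>\<^sub>m 1\<^sub>m 1) = det N \<cdot>\<^sub>m a"
      using a mult_smult_distrib[OF a, of "1\<^sub>m 1" 1 "det N"] by simp
    ultimately show ?thesis using a b c by simp
  qed
  ultimately show ?thesis by simp
qed

text \<open>For a nonzero minor \<open>N\<close> of largest order all bordered minors vanish, which
  gives every entry of \<open>det N\<close> times \<open>A\<close> as an entry of
  \<open>C * adj_mat N * B\<close>.\<close>

lemma rank_le_minor_rank:
  fixes A :: "'a::idom mat"
  shows "rank_le A (minor_rank A)"
proof -
  let ?r = "minor_rank A" and ?m = "dim_row A" and ?n = "dim_col A"
  have A: "A \<in> carrier_mat ?m ?n" by simp
  obtain f g where f: "\<And>i. i < ?r \<Longrightarrow> f i < ?m" and g: "\<And>j. j < ?r \<Longrightarrow> g j < ?n"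
    and nz: "det (index_minor A ?r f g) \<noteq> 0" using minor_rank_attained[OF A] by blast
  define N where "N = index_minor A ?r f g"
  define C where "C = mat ?m ?r (\<lambda>(i, t). A $$ (i, g t))"
  define B where "B = mat ?r ?n (\<lambda>(t, j). A $$ (f t, j))"
  have N: "N \<in> carrier_mat ?r ?r" by (simp add: N_def index_minor_def)
  have C: "C \<in> carrier_mat ?m ?r" and B: "B \<in> carrier_mat ?r ?n" by (simp_all add: C_def B_def)
  note adj = adj_mat[OF N]
  have "(det N \<cdot>\<^sub>m A) $$ (i, j) = (C * adj_mat N * B) $$ (i, j)" if ij: "i < ?m" "j < ?n" for i j
  proof -
    define b where "b = mat ?r 1 (\<lambda>(t, _). A $$ (f t, j))"
    define c where "c = mat 1 ?r (\<lambda>(_, t). A $$ (i, g t))"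
    define a where "a = mat 1 1 (\<lambda>_. A $$ (i, j))"
    \<comment> \<open>Row \<open>i\<close> and column \<open>j\<close> are appended at position
      \<open>?r\<close>, even if already selected; in that case the bordered minor has a repetition,
      which \<open>minor_rank_ge\<close> also covers.\<close>
    define f' where "f' t = (if t < ?r then f t else i)" for t
    define g' where "g' t = (if t < ?r then g t else j)" for t
    have "four_block_mat N b c a = index_minor A (?r + 1) f' g'"
      by (rule eq_matI) (auto simp: N_def index_minor_def b_def c_def a_def f'_def g'_def)
    moreover have "det (index_minor A (?r + 1) f' g') = 0"
    proof (rule ccontr)
      assume nz': "det (index_minor A (?r + 1) f' g') \<noteq> 0"
      have "?r + 1 \<le> ?r"
        using f g ij by (intro minor_rank_ge[OF A _ _ nz']) (auto simp: f'_def g'_def)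
      then show False by simp
    qed
    ultimately have "det N * a $$ (0, 0) = (c * adj_mat N * b) $$ (0, 0)"
      using nz N by (intro bordered_minor_zero[of _ ?r]) (auto simp: a_def b_def c_def N_def)
    also have "\<dots> = row (c * adj_mat N) 0 \<bullet> col b 0"
      using adj(1) by (simp add: b_def c_def)
    also have "row (c * adj_mat N) 0 = row (C * adj_mat N) i"
    proof -
      have "row c 0 = row C i" using ij by (auto simp: c_def C_def)
      then show ?thesis using ij adj(1) by (intro eq_vecI) (auto simp: c_def C_def)
    qed
    also have "col b 0 = col B j" using ij by (auto simp: b_def B_def)
    also have "row (C * adj_mat N) i \<bullet> col B j = (C * adj_mat N * B) $$ (i, j)"
      using ij C B by (subst index_mult_mat(1)) auto
    finally show ?thesis using ij by (simp add: a_def)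
  qed
  then have "det N \<cdot>\<^sub>m A = (C * adj_mat N) * B"
    using C B adj(1) by (intro eq_matI) auto
  moreover have "C * adj_mat N \<in> carrier_mat ?m ?r" using C adj(1) by simp
  ultimately show ?thesis using B nz unfolding rank_le_def N_def by blast
qed

text \<open>\<open>P\<close> and \<open>Q\<close> are absorbed into the outer sides of a
  factorization of a multiple of \<open>M\<close>.\<close>

lemma minor_rank_mult_le:
  fixes M :: "'a::idom mat"
  assumes M: "M \<in> carrier_mat m n" and P: "P \<in> carrier_mat a m" and Q: "Q \<in> carrier_mat n b"
  shows "minor_rank (P * M * Q) \<le> minor_rank M"
proof -
  let ?k = "minor_rank M"
  obtain h U V where h: "h \<noteq> 0" and U: "U \<in> carrier_mat m ?k" and V: "V \<in> carrier_mat ?k n"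
    and UV: "h \<cdot>\<^sub>m M = U * V" using rank_le_minor_rank[of M] M unfolding rank_le_def by auto
  have PM: "P * M \<in> carrier_mat a n" and PU: "P * U \<in> carrier_mat a ?k"
    using mult_carrier_mat[OF P M] mult_carrier_mat[OF P U] .
  have "h \<cdot>\<^sub>m (P * M * Q) = h \<cdot>\<^sub>m (P * M) * Q" by (rule mult_smult_assoc_mat[OF PM Q, symmetric])
  also have "h \<cdot>\<^sub>m (P * M) = P * (U * V)" using mult_smult_distrib[OF P M, of h] UV by simp
  also have "\<dots> = P * U * V" by (rule assoc_mult_mat[OF P U V, symmetric])
  also have "\<dots> * Q = (P * U) * (V * Q)" by (rule assoc_mult_mat[OF PU V Q])
  finally have "h \<cdot>\<^sub>m (P * M * Q) = (P * U) * (V * Q)" .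
  moreover have "V * Q \<in> carrier_mat ?k b" by (rule mult_carrier_mat[OF V Q])
  moreover have "dim_row (P * M * Q) = a" "dim_col (P * M * Q) = b" using P Q by simp_all
  ultimately have "rank_le (P * M * Q) ?k" using h PU unfolding rank_le_def by metis
  then show ?thesis by (rule minor_rank_le_if_rank_le)
qed

lemma minor_rank_le_smult:
  fixes M :: "'a::idom mat"
  assumes "h \<noteq> 0"
  shows "minor_rank M \<le> minor_rank (h \<cdot>\<^sub>m M)"
proof -
  obtain e U V where e: "e \<noteq> 0" and UV: "U \<in> carrier_mat (dim_row M) (minor_rank (h \<cdot>\<^sub>m M))"
    "V \<in> carrier_mat (minor_rank (h \<cdot>\<^sub>m M)) (dim_col M)" "e \<cdot>\<^sub>m (h \<cdot>\<^sub>m M) = U * V"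
    using rank_le_minor_rank[of "h \<cdot>\<^sub>m M"] unfolding rank_le_def by auto
  have "(e * h) \<cdot>\<^sub>m M = U * V" unfolding UV(3)[symmetric] by (auto simp: mult.assoc)
  then have "rank_le M (minor_rank (h \<cdot>\<^sub>m M))"
    using e assms UV unfolding rank_le_def by (metis mult_eq_0_iff)
  then show ?thesis by (rule minor_rank_le_if_rank_le)
qed

lemma minor_rank_one: "minor_rank (1\<^sub>m n :: 'a::idom mat) = n"
proof (rule antisym)
  have "rank_le (1\<^sub>m n :: 'a mat) n"
    unfolding rank_le_def
    by (rule exI[of _ 1], rule exI[of _ "1\<^sub>m n"], rule exI[of _ "1\<^sub>m n"]) auto
  then show "minor_rank (1\<^sub>m n :: 'a mat) \<le> n" by (rule minor_rank_le_if_rank_le)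
  have "index_minor (1\<^sub>m n :: 'a mat) n (\<lambda>i. i) (\<lambda>j. j) = 1\<^sub>m n"
    by (auto simp: index_minor_def)
  then show "n \<le> minor_rank (1\<^sub>m n :: 'a mat)"
    by (intro minor_rank_ge[of _ n n n "\<lambda>i. i" "\<lambda>j. j"]) auto
qed

lemma det_nonzero_if_full_minor_rank:
  fixes A :: "'a::comm_ring_1 mat"
  assumes "A \<in> carrier_mat n n" "minor_rank A = n"
  shows "det A \<noteq> 0"
proof -
  obtain f g where "\<And>i. i < n \<Longrightarrow> f i < n" "\<And>j. j < n \<Longrightarrow> g j < n" "det (index_minor A n f g) \<noteq> 0"
    using minor_rank_attained[OF assms(1), unfolded assms(2)] by blast
  then show ?thesis using det_index_minor_square[OF assms(1)] by blast
qed

section \<open>Rank factorization and strong shift equivalence\<close>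

text \<open>A nonzero multiple of \<open>A\<close> factors through the rank by
  \<open>rank_le_minor_rank\<close>; the multiplier is then cancelled with the inner dimension
  unchanged.\<close>

theorem rank_factorization:
  fixes A :: "'a::pid poly mat"
  assumes A: "A \<in> carrier_mat m n"
  obtains U V where "U \<in> carrier_mat m (minor_rank A)" "V \<in> carrier_mat (minor_rank A) n" "A = U * V"
proof -
  let ?r = "minor_rank A"
  obtain h U V where h: "h \<noteq> 0" and U: "U \<in> carrier_mat m ?r" and V: "V \<in> carrier_mat ?r n"
    and UV: "h \<cdot>\<^sub>m A = U * V" using rank_le_minor_rank[of A] A unfolding rank_le_def by auto
  have "h * A $$ (i, j) = (\<Sum>t<?r. U $$ (i, t) * V $$ (t, j))" if "i < m" "j < n" for i j
  proof -
    have "h * A $$ (i, j) = (U * V) $$ (i, j)" unfolding UV[symmetric] using A that by simp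
    then show ?thesis using U V that by (simp add: scalar_prod_def atLeast0LessThan)
  qed
  then have "factors_through m n ?r (\<lambda>i j. h * A $$ (i, j))"
    unfolding factors_through_def
    by (intro exI[of _ "\<lambda>i t. U $$ (i, t)"] exI[of _ "\<lambda>t j. V $$ (t, j)"]) simp
  then have "factors_through m n ?r (\<lambda>i j. A $$ (i, j))" using h by (rule factors_through_cancel_poly[rotated])
  then obtain U' V' where UV': "\<And>i j. i < m \<Longrightarrow> j < n \<Longrightarrow> A $$ (i, j) = (\<Sum>t<?r. U' i t * V' t j)"
    unfolding factors_through_def by blast
  have "A = mat m ?r (\<lambda>(i, t). U' i t) * mat ?r n (\<lambda>(t, j). V' t j)"
    using A by (intro eq_matI) (simp_all add: UV' scalar_prod_def atLeast0LessThan)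
  then show thesis using that by (metis mat_carrier)
qed

text \<open>A nonzero minor of order \<open>r\<close> of \<open>U * V\<close> is the product of
  minors of order \<open>r\<close> of \<open>U\<close> and of \<open>V\<close>. Both are nonzero,
  and their adjugates give one-sided inverses up to scalars.\<close>

lemma rank_factorization_one_sided_inverses:
  fixes U V :: "'a::idom mat"
  assumes U: "U \<in> carrier_mat m r" and V: "V \<in> carrier_mat r n" and r: "minor_rank (U * V) = r"
  obtains W X h h' where "W \<in> carrier_mat r m" "X \<in> carrier_mat n r" "h \<noteq> 0" "h' \<noteq> 0"
    "W * U = h \<cdot>\<^sub>m 1\<^sub>m r" "V * X = h' \<cdot>\<^sub>m 1\<^sub>m r"
proof -
  obtain f g where f: "\<And>i. i < r \<Longrightarrow> f i < m" and g: "\<And>j. j < r \<Longrightarrow> g j < n"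
    and nz: "det (index_minor (U * V) r f g) \<noteq> 0"
    using minor_rank_attained[OF mult_carrier_mat[OF U V], unfolded r] by blast
  define F where "F = row_selection r m f * U"
  define G where "G = V * col_selection n r g"
  have F: "F \<in> carrier_mat r r" and G: "G \<in> carrier_mat r r"
    unfolding F_def G_def
    by (rule mult_carrier_mat[OF selection_carrier(1) U] mult_carrier_mat[OF V selection_carrier(2)])+
  have "det F * det G \<noteq> 0"
    using nz index_minor_mult[OF U V f g] det_mult[OF F G] unfolding F_def G_def by simp
  then have nz: "det F \<noteq> 0" "det G \<noteq> 0" by auto
  have "adj_mat F * row_selection r m f * U = adj_mat F * F"
    unfolding F_def by (rule assoc_mult_mat[OF _ _ U]) (use adj_mat(1)[OF F] in \<open>auto simp: F_def\<close>)
  then have W: "adj_mat F * row_selection r m f * U = det F \<cdot>\<^sub>m 1\<^sub>m r" using adj_mat(3)[OF F] by simp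
  have "V * (col_selection n r g * adj_mat G) = G * adj_mat G"
    unfolding G_def by (rule assoc_mult_mat[OF V, symmetric]) (use adj_mat(1)[OF G] in \<open>auto simp: G_def\<close>)
  then have X: "V * (col_selection n r g * adj_mat G) = det G \<cdot>\<^sub>m 1\<^sub>m r" using adj_mat(2)[OF G] by simp
  show thesis
    by (rule that[OF _ _ nz W X])
      (rule mult_carrier_mat[OF adj_mat(1)[OF F] selection_carrier(1)]
            mult_carrier_mat[OF selection_carrier(2) adj_mat(1)[OF G]])+
qed

lemma pow_mat_swap_factors:
  fixes U V :: "'a::comm_ring_1 mat"
  assumes U: "U \<in> carrier_mat n r" and V: "V \<in> carrier_mat r n"
  shows "(U * V) ^\<^sub>m Suc k = U * (V * U) ^\<^sub>m k * V"
proof (induction k)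
  case 0
  then show ?case using U V by simp
next
  case (Suc k)
  have C: "V * U \<in> carrier_mat r r" using mult_carrier_mat[OF V U] .
  then have Ck: "(V * U) ^\<^sub>m k \<in> carrier_mat r r" by simp
  have UC: "U * (V * U) ^\<^sub>m k \<in> carrier_mat n r" using mult_carrier_mat[OF U Ck] .
  have "(U * V) ^\<^sub>m Suc (Suc k) = U * (V * U) ^\<^sub>m k * V * (U * V)" using Suc by simp
  also have "\<dots> = U * (V * U) ^\<^sub>m k * (V * (U * V))"
    using assoc_mult_mat[OF UC V mult_carrier_mat[OF U V]] .
  also have "V * (U * V) = V * U * V" using assoc_mult_mat[OF V U V] by simp
  also have "U * (V * U) ^\<^sub>m k * (V * U * V) = U * (V * U) ^\<^sub>m k * (V * U) * V"
    using assoc_mult_mat[OF UC C V] by simp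
  also have "U * (V * U) ^\<^sub>m k * (V * U) = U * (V * U) ^\<^sub>m Suc k"
    using assoc_mult_mat[OF U Ck C] by simp
  finally show ?case .
qed

text \<open>The power of \<open>U * V\<close> is the power of \<open>V * U\<close> between
  \<open>U\<close> and \<open>V\<close>, which bounds its rank; multiplying by \<open>W\<close> and
  \<open>X\<close> recovers the inner power up to nonzero scalars, which do not lower the
  rank.\<close>

lemma minor_rank_swap_factors:
  fixes U V :: "'a::idom mat"
  assumes U: "U \<in> carrier_mat n r" and V: "V \<in> carrier_mat r n" and r: "minor_rank (U * V) = r"
  shows "minor_rank ((V * U) ^\<^sub>m k) = minor_rank ((U * V) ^\<^sub>m Suc k)"
proof (rule antisym)
  have C: "(V * U) ^\<^sub>m k \<in> carrier_mat r r" using mult_carrier_mat[OF V U] by simp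
  show "minor_rank ((U * V) ^\<^sub>m Suc k) \<le> minor_rank ((V * U) ^\<^sub>m k)"
    unfolding pow_mat_swap_factors[OF U V] by (rule minor_rank_mult_le[OF C U V])
  obtain W X h h' where W: "W \<in> carrier_mat r n" and X: "X \<in> carrier_mat n r" and h: "h \<noteq> 0" "h' \<noteq> 0"
    and WU: "W * U = h \<cdot>\<^sub>m 1\<^sub>m r" and VX: "V * X = h' \<cdot>\<^sub>m 1\<^sub>m r"
    using rank_factorization_one_sided_inverses[OF U V r] .
  let ?C = "(V * U) ^\<^sub>m k"
  have UC: "U * ?C \<in> carrier_mat n r" using mult_carrier_mat[OF U C] .
  have "W * (U * ?C * V) * X = W * (U * ?C) * V * X" using assoc_mult_mat[OF W UC V] by simp
  also have "W * (U * ?C) = W * U * ?C" using assoc_mult_mat[OF W U C] by simp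
  also have "\<dots> = h \<cdot>\<^sub>m ?C" unfolding WU using mult_smult_assoc_mat[OF _ C, of "1\<^sub>m r" r h] left_mult_one_mat[OF C] by simp
  also have "h \<cdot>\<^sub>m ?C * V * X = h \<cdot>\<^sub>m ?C * (V * X)"
    by (rule assoc_mult_mat[OF smult_carrier_mat[OF C] V X])
  also have "\<dots> = h' \<cdot>\<^sub>m (h \<cdot>\<^sub>m ?C)"
    unfolding VX
    using mult_smult_distrib[of "h \<cdot>\<^sub>m ?C" r r "1\<^sub>m r" r h'] C
      right_mult_one_mat[OF smult_carrier_mat[OF C]] by simp
  finally have eq: "W * (U * ?C * V) * X = h' \<cdot>\<^sub>m (h \<cdot>\<^sub>m ?C)" .
  have "minor_rank ?C \<le> minor_rank (h' \<cdot>\<^sub>m (h \<cdot>\<^sub>m ?C))"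
    using minor_rank_le_smult[OF h(1), of ?C] minor_rank_le_smult[OF h(2), of "h \<cdot>\<^sub>m ?C"] by simp
  also have "\<dots> \<le> minor_rank (U * ?C * V)"
    unfolding eq[symmetric] by (rule minor_rank_mult_le[OF mult_carrier_mat[OF UC V] W X])
  finally show "minor_rank ?C \<le> minor_rank ((U * V) ^\<^sub>m Suc k)"
    unfolding pow_mat_swap_factors[OF U V] .
qed

text \<open>The case \<open>k = 0\<close> records the order of \<open>C\<close>: the zeroth power is
  the identity of that order, so the order equals the rank of \<open>A\<close>.\<close>

lemma elem_sse_minor_rank:
  fixes A :: "'a::pid poly mat"
  assumes A: "square_mat A"
  shows "\<exists>C. square_mat C \<and> elem_sse A C \<and> (\<forall>k. minor_rank (C ^\<^sub>m k) = minor_rank (A ^\<^sub>m Suc k))"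
proof -
  let ?n = "dim_row A" and ?r = "minor_rank A"
  have A': "A \<in> carrier_mat ?n ?n" using A by auto
  obtain U V where U: "U \<in> carrier_mat ?n ?r" and V: "V \<in> carrier_mat ?r ?n" and UV: "A = U * V"
    using rank_factorization[OF A'] .
  have C: "V * U \<in> carrier_mat ?r ?r" using mult_carrier_mat[OF V U] .
  have "elem_sse A (V * U)"
    unfolding elem_sse_def using U V UV C A' by (metis carrier_matD(1))
  moreover have "minor_rank ((V * U) ^\<^sub>m k) = minor_rank (A ^\<^sub>m Suc k)" for k
    using minor_rank_swap_factors[OF U V] UV by simp
  moreover have "square_mat (V * U)" using U V by simp
  ultimately show ?thesis by blast
qed

lemma minor_rank_powers_stabilize:
  fixes A :: "'a::idom mat"
  assumes A: "A \<in> carrier_mat n n"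
  shows "\<exists>k. minor_rank (A ^\<^sub>m k) = minor_rank (A ^\<^sub>m Suc k)"
proof -
  have mono: "minor_rank (A ^\<^sub>m Suc k) \<le> minor_rank (A ^\<^sub>m k)" for k
  proof -
    have Ak: "A ^\<^sub>m k \<in> carrier_mat n n" using A by simp
    show ?thesis
      using minor_rank_mult_le[OF Ak one_carrier_mat A] left_mult_one_mat[OF Ak] by simp
  qed
  \<comment> \<open>At an exponent of least rank the next rank can be neither smaller nor, by
    \<open>mono\<close>, larger.\<close>
  obtain k where "\<And>j. minor_rank (A ^\<^sub>m k) \<le> minor_rank (A ^\<^sub>m j)"
    using ex_has_least_nat[of "\<lambda>_. True" 0 "\<lambda>k. minor_rank (A ^\<^sub>m k)"] by blast
  then show ?thesis using mono le_antisym by blast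
qed

lemma alg_sse_lag_nonsingular:
  fixes A :: "'a::pid poly mat"
  assumes A: "A \<in> carrier_mat n n" and l: "minor_rank (A ^\<^sub>m l) = minor_rank (A ^\<^sub>m Suc l)"
  shows "\<exists>m B. B \<in> carrier_mat m m \<and> det B \<noteq> 0 \<and> alg_sse_lag l A B"
proof -
  obtain step :: "'a poly mat \<Rightarrow> 'a poly mat" where step: "\<And>A. square_mat A \<Longrightarrow> square_mat (step A) \<and>
      elem_sse A (step A) \<and> (\<forall>k. minor_rank (step A ^\<^sub>m k) = minor_rank (A ^\<^sub>m Suc k))"
    using elem_sse_minor_rank by metis
  define C where "C i = (step ^^ i) A" for i
  have square: "square_mat (C i)" for i
    by (induction i) (use A step in \<open>auto simp: C_def\<close>)
  have rank: "minor_rank (C i ^\<^sub>m k) = minor_rank (A ^\<^sub>m (i + k))" for i k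
  proof (induction i arbitrary: k)
    case (Suc i)
    have "minor_rank (C (Suc i) ^\<^sub>m k) = minor_rank (C i ^\<^sub>m Suc k)"
      using step[OF square[of i]] by (simp add: C_def)
    then show ?case using Suc[of "Suc k"] by simp
  qed (simp add: C_def)
  let ?s = "dim_row (C l)"
  have Cl: "C l \<in> carrier_mat ?s ?s" using square[of l] by auto
  \<comment> \<open>The order of \<open>C l\<close> is the rank of its zeroth power, which is the
    rank of \<open>A ^\<^sub>m l\<close>; the rank of its first power is that of the next power of
    \<open>A\<close>. The hypothesis equates the two, so \<open>C l\<close> has full rank.\<close>
  have "?s = minor_rank (C l ^\<^sub>m 0)" by (simp add: minor_rank_one)
  also have "\<dots> = minor_rank (C l ^\<^sub>m 1)" using rank[of l 0] rank[of l 1] l by simp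
  also have "\<dots> = minor_rank (C l)" using left_mult_one_mat[OF Cl] by simp
  finally have "det (C l) \<noteq> 0" using det_nonzero_if_full_minor_rank[OF Cl] by metis
  moreover have "elem_sse (C i) (C (Suc i))" for i
    using step[OF square[of i]] by (simp add: C_def)
  then have "alg_sse_lag l A (C l)"
    unfolding alg_sse_lag_def
    using square by (intro exI[of _ C]) (auto simp: C_def)
  ultimately show ?thesis using Cl by blast
qed

theorem theorem1p1:
  fixes A :: "'a::pid poly mat" and n :: nat
  assumes "A \<in> carrier_mat n n"
    and "\<not> nilpotent_mat A"
  shows "(\<exists>m B. B \<in> carrier_mat m m \<and> det B \<noteq> 0 \<and>
           alg_sse_lag (LEAST k. minor_rank (A ^\<^sub>m k) = minor_rank (A ^\<^sub>m (Suc k))) A B) \<and>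
         (\<exists>l m B. B \<in> carrier_mat m m \<and> det B \<noteq> 0 \<and> alg_sse_lag l A B)"
proof -
  let ?l = "LEAST k. minor_rank (A ^\<^sub>m k) = minor_rank (A ^\<^sub>m (Suc k))"
  have "minor_rank (A ^\<^sub>m ?l) = minor_rank (A ^\<^sub>m Suc ?l)"
    using minor_rank_powers_stabilize[OF assms(1)] by (rule LeastI_ex)
  from alg_sse_lag_nonsingular[OF assms(1) this] show ?thesis by blast
qed

end
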